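(* Let $N\ge 0$ and let $P$ be the transition matrix of an irreducible symmetric discrete-time birth-and-death chain on $\{0,\ldots,2N+1\}$. If $P$ is monotone, then $N+1$ is a halting state for the total variation distance for the chain started at $0$.
   Context: A birth-and-death chain on $\{0,\ldots,M\}$ is a Markov chain with transition kernel $k$ satisfying $k(x,y)=0$ for $|x-y|>1$; put $p_x=k(x,x+1)$, $q_x=k(x,x-1)$, $r_x=k(x,x)$. Irreducibility means $p_x>0$ for $0\le x\le M-1$ and $q_x>0$ for $1\le x\le M$. It is monotone if $p_x+q_{x+1}\le 1$ for all $0\le x\le M-1$. It is symmetric if $k(M-x,M-y)=k(x,y)$ for all $x,y$. Here $M=2N+1$. Let $\pi$ be the stationary distribution and $\pi_n=P^n(0,\cdot)$. A state $x^*$ is a halting state for total variation for the chain started at $0$ if $\pi_n(x^* )\le\pi(x^* )$ for all $n\ge0$ (in particular then $\|\pi_n-\pi\|_{TV}\le\mathbb{P}(T_{x^*}>n)$ for all $n$, where $T_{x^*}$ is the hitting time of $x^*$). *)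

theory Defs
  imports "Jordan_Normal_Form.Matrix"
begin

text \<open>A chain on the states \<open>0, \<dots>, M\<close> is given by its transition matrix, of size \<open>M + 1\<close>;
  distributions are vectors of the same size and act on matrices from the left.\<close>

definition probability_vec :: "nat \<Rightarrow> real vec \<Rightarrow> bool" where
  "probability_vec n v \<longleftrightarrow>
     v \<in> carrier_vec n \<and> (\<forall>x<n. 0 \<le> v $ x) \<and> (\<Sum>x<n. v $ x) = 1"

definition transition_matrix :: "nat \<Rightarrow> real mat \<Rightarrow> bool" where
  "transition_matrix n P \<longleftrightarrow>
     P \<in> carrier_mat n n \<and> (\<forall>x<n. probability_vec n (row P x))"

definition birth_death_chain :: "nat \<Rightarrow> real mat \<Rightarrow> bool" where
  "birth_death_chain M P \<longleftrightarrow>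
     transition_matrix (M + 1) P \<and>
     (\<forall>x\<le>M. \<forall>y\<le>M. \<bar>int x - int y\<bar> > 1 \<longrightarrow> P $$ (x, y) = 0)"

definition birth_prob :: "real mat \<Rightarrow> nat \<Rightarrow> real" where
  "birth_prob P x = P $$ (x, x + 1)"

text \<open>Only meaningful for \<open>x \<ge> 1\<close>, because subtraction on \<open>nat\<close> truncates.\<close>

definition death_prob :: "real mat \<Rightarrow> nat \<Rightarrow> real" where
  "death_prob P x = P $$ (x, x - 1)"

definition irreducible_bd :: "nat \<Rightarrow> real mat \<Rightarrow> bool" where
  "irreducible_bd M P \<longleftrightarrow>
     (\<forall>x<M. birth_prob P x > 0) \<and> (\<forall>x\<in>{1..M}. death_prob P x > 0)"

definition monotone_bd :: "nat \<Rightarrow> real mat \<Rightarrow> bool" where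
  "monotone_bd M P \<longleftrightarrow> (\<forall>x<M. birth_prob P x + death_prob P (x + 1) \<le> 1)"

definition symmetric_bd :: "nat \<Rightarrow> real mat \<Rightarrow> bool" where
  "symmetric_bd M P \<longleftrightarrow> (\<forall>x\<le>M. \<forall>y\<le>M. P $$ (M - x, M - y) = P $$ (x, y))"

text \<open>The equation \<open>\<pi>P = \<pi>\<close> for a row vector, written with the transpose.\<close>

definition stationary_distribution :: "nat \<Rightarrow> real mat \<Rightarrow> real vec \<Rightarrow> bool" where
  "stationary_distribution M P \<pi> \<longleftrightarrow>
     probability_vec (M + 1) \<pi> \<and> P\<^sup>T *\<^sub>v \<pi> = \<pi>"

definition law_at :: "real mat \<Rightarrow> nat \<Rightarrow> nat \<Rightarrow> real vec" where
  "law_at P x n = row (P ^\<^sub>m n) x"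

definition tv_halting_state :: "nat \<Rightarrow> real mat \<Rightarrow> real vec \<Rightarrow> nat \<Rightarrow> nat \<Rightarrow> bool" where
  "tv_halting_state M P \<pi> x s \<longleftrightarrow> s \<le> M \<and> (\<forall>n. law_at P x n $ s \<le> \<pi> $ s)"

end

theory Submission
  imports Defs
begin

text \<open>
  Write \<open>M = 2N + 1\<close> and \<open>g\<^sub>n(x) = P\<^sup>n(x, 0)\<close>. A stationary distribution of a birth-and-death
  chain satisfies detailed balance, because there is no net flow of mass through any edge; hence
  \<open>\<pi>(0) P\<^sup>n(0, N + 1) = \<pi>(N + 1) g\<^sub>n(N + 1)\<close>, and since \<open>\<pi>(0) > 0\<close> it suffices to show
  \<open>g\<^sub>n(N + 1) \<le> \<pi>(0)\<close>.

  The functions \<open>g\<^sub>n\<close> arise from the indicator of \<open>0\<close> by iterating the averaging operator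
  \<open>f \<mapsto> Pf\<close>. Two monotonicity properties survive the iteration. First, \<open>g\<^sub>n\<close> is nonincreasing
  on \<open>{0, \<dots>, M}\<close>, as \<open>P\<close> is monotone. Secondly, the symmetrised function
  \<open>e\<^sub>n(x) = g\<^sub>n(x) + g\<^sub>n(M - x)\<close> is nonincreasing on \<open>{0, \<dots>, N}\<close>: it is essentially a function
  of the chain folded at its midpoint, which is again monotone. Both facts follow from one local
  computation (\<open>one_step_decreasing_at\<close>): the increment of \<open>Pf\<close> over an edge is a combination,
  with nonnegative weights, of the increments of \<open>f\<close> over this edge and the two adjacent ones,
  and the increment of \<open>e\<^sub>n\<close> over the middle edge vanishes.

  So \<open>e\<^sub>n\<close> is minimal at the two middle states \<open>N\<close> and \<open>N + 1\<close>, whence \<open>e\<^sub>n(N)\<close> is at most the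
  \<open>\<pi>\<close>-average of \<open>e\<^sub>n\<close>. That average is \<open>2\<pi>(0)\<close>, because \<open>\<pi>\<close> is symmetric and \<open>g\<^sub>n\<close> has
  \<open>\<pi>\<close>-average \<open>\<pi>(0)\<close> by stationarity. Finally \<open>g\<^sub>n(N + 1) \<le> g\<^sub>n(N)\<close> gives
  \<open>2 g\<^sub>n(N + 1) \<le> e\<^sub>n(N) \<le> 2\<pi>(0)\<close>.
\<close>

section \<open>Averaging operators and powers of a transition matrix\<close>

definition one_step :: "nat \<Rightarrow> real mat \<Rightarrow> (nat \<Rightarrow> real) \<Rightarrow> nat \<Rightarrow> real" where
  "one_step M P f x = (\<Sum>y\<le>M. P $$ (x, y) * f y)"

definition detailed_balance :: "nat \<Rightarrow> real mat \<Rightarrow> (nat \<Rightarrow> real) \<Rightarrow> bool" where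
  "detailed_balance M P a \<longleftrightarrow> (\<forall>x\<le>M. \<forall>y\<le>M. a x * P $$ (x, y) = a y * P $$ (y, x))"

lemma index_mult_mat_atMost:
  fixes A B :: "real mat"
  assumes "A \<in> carrier_mat (M + 1) (M + 1)" "B \<in> carrier_mat (M + 1) (M + 1)" "x \<le> M" "y \<le> M"
  shows "(A * B) $$ (x, y) = (\<Sum>z\<le>M. A $$ (x, z) * B $$ (z, y))"
  using assms
  by (auto simp: scalar_prod_def lessThan_Suc_atMost atLeast0LessThan intro!: sum.cong)

lemma pow_mat_Suc_left:
  fixes P :: "real mat"
  assumes "P \<in> carrier_mat m m"
  shows "P ^\<^sub>m Suc n = P * P ^\<^sub>m n"
proof (induction n)
  case 0
  then show ?case using assms by simp
next
  case (Suc n)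
  have "P ^\<^sub>m Suc (Suc n) = (P * P ^\<^sub>m n) * P" using Suc by simp
  also have "\<dots> = P * (P ^\<^sub>m n * P)"
    using assms by (intro assoc_mult_mat[of _ m m _ m _ m]) auto
  finally show ?case by simp
qed

lemma pow_mat_Suc_eq_one_step:
  assumes P: "P \<in> carrier_mat (M + 1) (M + 1)" and "x \<le> M" "y \<le> M"
  shows "(P ^\<^sub>m Suc n) $$ (x, y) = one_step M P (\<lambda>z. (P ^\<^sub>m n) $$ (z, y)) x"
  unfolding pow_mat_Suc_left[OF P] one_step_def
  by (rule index_mult_mat_atMost) (use assms in auto)

lemma detailed_balance_pow_mat:
  assumes P: "P \<in> carrier_mat (M + 1) (M + 1)" and db: "detailed_balance M P a"
  shows "detailed_balance M (P ^\<^sub>m n) a"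
proof (induction n)
  case 0
  then show ?case using P by (auto simp: detailed_balance_def)
next
  case (Suc n)
  have pc: "P ^\<^sub>m n \<in> carrier_mat (M + 1) (M + 1)" using P by auto
  show ?case unfolding detailed_balance_def
  proof (intro allI impI)
    fix x y assume xy: "x \<le> M" "y \<le> M"
    have "a x * (P ^\<^sub>m Suc n) $$ (x, y) = (\<Sum>z\<le>M. (a x * P $$ (x, z)) * (P ^\<^sub>m n) $$ (z, y))"
      unfolding pow_mat_Suc_left[OF P]
      by (subst index_mult_mat_atMost[OF P pc xy]) (simp add: sum_distrib_left mult.assoc)
    also have "\<dots> = (\<Sum>z\<le>M. (a z * (P ^\<^sub>m n) $$ (z, y)) * P $$ (z, x))"
      using db xy by (intro sum.cong) (auto simp: detailed_balance_def)
    also have "\<dots> = (\<Sum>z\<le>M. a y * ((P ^\<^sub>m n) $$ (y, z) * P $$ (z, x)))"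
      using Suc xy by (intro sum.cong) (auto simp: detailed_balance_def)
    also have "\<dots> = a y * (P ^\<^sub>m Suc n) $$ (y, x)"
      using index_mult_mat_atMost[OF pc P xy(2) xy(1)] by (simp add: sum_distrib_left)
    finally show "a x * (P ^\<^sub>m Suc n) $$ (x, y) = a y * (P ^\<^sub>m Suc n) $$ (y, x)" .
  qed
qed

lemma transition_matrix_carrier: "transition_matrix n P \<Longrightarrow> P \<in> carrier_mat n n"
  by (simp add: transition_matrix_def)

lemma transition_matrix_nonneg:
  "transition_matrix n P \<Longrightarrow> x < n \<Longrightarrow> y < n \<Longrightarrow> 0 \<le> P $$ (x, y)"
  by (auto simp: transition_matrix_def probability_vec_def)

lemma transition_matrix_row_sum:
  assumes "transition_matrix (M + 1) P" "x \<le> M"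
  shows "(\<Sum>y\<le>M. P $$ (x, y)) = 1"
proof -
  have "(\<Sum>y<M+1. row P x $ y) = 1"
    using assms by (auto simp: transition_matrix_def probability_vec_def)
  moreover have "(\<Sum>y<M+1. row P x $ y) = (\<Sum>y\<le>M. P $$ (x, y))"
    using assms by (intro sum.cong) (auto simp: transition_matrix_def)
  ultimately show ?thesis by simp
qed

lemma stationary_distribution_eq:
  assumes "P \<in> carrier_mat (M + 1) (M + 1)" "stationary_distribution M P \<pi>" "x \<le> M"
  shows "(\<Sum>z\<le>M. \<pi> $ z * P $$ (z, x)) = \<pi> $ x"
proof -
  have c: "\<pi> \<in> carrier_vec (M + 1)" and e: "P\<^sup>T *\<^sub>v \<pi> = \<pi>"
    using assms(2) by (auto simp: stationary_distribution_def probability_vec_def)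
  have "(P\<^sup>T *\<^sub>v \<pi>) $ x = (\<Sum>z\<le>M. \<pi> $ z * P $$ (z, x))"
    using assms(1,3) c
    by (auto simp: scalar_prod_def atLeast0LessThan lessThan_Suc_atMost intro!: sum.cong)
  with e show ?thesis by simp
qed

lemma sum_stationary_one_step:
  assumes "P \<in> carrier_mat (M + 1) (M + 1)" "stationary_distribution M P \<pi>"
  shows "(\<Sum>x\<le>M. \<pi> $ x * one_step M P f x) = (\<Sum>x\<le>M. \<pi> $ x * f x)"
proof -
  have "(\<Sum>x\<le>M. \<pi> $ x * one_step M P f x) = (\<Sum>y\<le>M. \<Sum>x\<le>M. \<pi> $ x * (P $$ (x, y) * f y))"
    unfolding one_step_def sum_distrib_left by (rule sum.swap)
  also have "\<dots> = (\<Sum>y\<le>M. (\<Sum>x\<le>M. \<pi> $ x * P $$ (x, y)) * f y)"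
    by (simp add: sum_distrib_right mult.assoc)
  also have "\<dots> = (\<Sum>y\<le>M. \<pi> $ y * f y)"
    using stationary_distribution_eq[OF assms] by (intro sum.cong) auto
  finally show ?thesis .
qed

lemma sum_stationary_pow_mat:
  assumes P: "P \<in> carrier_mat (M + 1) (M + 1)" and st: "stationary_distribution M P \<pi>" and "y \<le> M"
  shows "(\<Sum>x\<le>M. \<pi> $ x * (P ^\<^sub>m n) $$ (x, y)) = \<pi> $ y"
proof (induction n)
  case 0
  have "(\<Sum>x\<le>M. \<pi> $ x * (P ^\<^sub>m 0) $$ (x, y)) = (\<Sum>x\<le>M. if y = x then \<pi> $ x else 0)"
    using P \<open>y \<le> M\<close> by (intro sum.cong) auto
  then show ?case using \<open>y \<le> M\<close> by simp
next
  case (Suc n)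
  have "(\<Sum>x\<le>M. \<pi> $ x * (P ^\<^sub>m Suc n) $$ (x, y))
      = (\<Sum>x\<le>M. \<pi> $ x * one_step M P (\<lambda>z. (P ^\<^sub>m n) $$ (z, y)) x)"
    using pow_mat_Suc_eq_one_step[OF P _ \<open>y \<le> M\<close>] by (intro sum.cong) auto
  then show ?case using Suc by (simp add: sum_stationary_one_step[OF P st])
qed

section \<open>Reversibility of birth-and-death chains\<close>

lemma sum_nearest_neighbours:
  fixes g :: "nat \<Rightarrow> real"
  assumes "x \<le> M" and "g x = 0"
    and "\<And>y. y \<le> M \<Longrightarrow> \<bar>int x - int y\<bar> > 1 \<Longrightarrow> g y = 0"
  shows "(\<Sum>y\<le>M. g y) = (if x < M then g (x + 1) else 0) + (if 0 < x then g (x - 1) else 0)"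
proof -
  have "(\<Sum>y\<le>M. g y)
      = (\<Sum>y\<le>M. (if y = x + 1 then g y else 0) + (if y = x - 1 then if 0 < x then g y else 0 else 0))"
  proof (rule sum.cong[OF refl])
    fix y assume "y \<in> {..M}"
    show "g y = (if y = x + 1 then g y else 0)
        + (if y = x - 1 then if 0 < x then g y else 0 else 0)"
    proof (cases "\<bar>int x - int y\<bar> > 1")
      case True
      then show ?thesis using assms(3) \<open>y \<in> {..M}\<close> by auto
    next
      case False
      then consider "y = x" | "y = x + 1" | "x = y + 1" by linarith
      then show ?thesis using assms(2) by cases simp_all
    qed
  qed
  also have "\<dots> = (if x < M then g (x + 1) else 0) + (if 0 < x then g (x - 1) else 0)"
    using assms(1) by (auto simp: sum.distrib)
  finally show ?thesis .
qed

text \<open>Stationarity says that the net inflow into each state vanishes. The state \<open>0\<close> has only one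
  edge, so the net flow along that edge vanishes, and then so does, inductively, the flow along
  each subsequent edge.\<close>

lemma stationary_birth_death_detailed_balance:
  assumes bd: "birth_death_chain M P" and st: "stationary_distribution M P \<pi>"
  shows "detailed_balance M P (($) \<pi>)"
proof -
  have tm: "transition_matrix (M + 1) P"
    and far: "\<And>x y. x \<le> M \<Longrightarrow> y \<le> M \<Longrightarrow> \<bar>int x - int y\<bar> > 1 \<Longrightarrow> P $$ (x, y) = 0"
    using bd by (auto simp: birth_death_chain_def)
  define flow where "flow z x = \<pi> $ z * P $$ (z, x) - \<pi> $ x * P $$ (x, z)" for z x
  have inflow: "(if x < M then flow (x + 1) x else 0) + (if 0 < x then flow (x - 1) x else 0) = 0"
    if x: "x \<le> M" for x
  proof -
    have "(\<Sum>z\<le>M. flow z x) = (\<Sum>z\<le>M. \<pi> $ z * P $$ (z, x)) - \<pi> $ x * (\<Sum>z\<le>M. P $$ (x, z))"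
      by (simp add: flow_def sum_subtractf sum_distrib_left)
    also have "\<dots> = 0"
      using stationary_distribution_eq[OF transition_matrix_carrier[OF tm] st x]
        transition_matrix_row_sum[OF tm x] by simp
    finally have total: "(\<Sum>z\<le>M. flow z x) = 0" .
    have "(\<Sum>z\<le>M. flow z x)
      = (if x < M then flow (x + 1) x else 0) + (if 0 < x then flow (x - 1) x else 0)"
      by (rule sum_nearest_neighbours[OF x]) (use far x in \<open>auto simp: flow_def\<close>)
    with total show ?thesis by simp
  qed
  have edge: "flow (x + 1) x = 0" if "x < M" for x
    using that
  proof (induction x)
    case 0
    then show ?case using inflow[of 0] by simp
  next
    case (Suc x)
    moreover have "flow x (Suc x) = - flow (x + 1) x" by (simp add: flow_def)
    ultimately show ?case using inflow[of "Suc x"] by simp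
  qed
  show ?thesis unfolding detailed_balance_def
  proof (intro allI impI)
    fix x y assume "x \<le> M" "y \<le> M"
    consider "y = x" | "y = x + 1" | "x = y + 1" | "\<bar>int x - int y\<bar> > 1" by linarith
    then show "\<pi> $ x * P $$ (x, y) = \<pi> $ y * P $$ (y, x)"
    proof cases
      case 2
      then show ?thesis using edge[of x] \<open>y \<le> M\<close> by (simp add: flow_def)
    next
      case 3
      then show ?thesis using edge[of y] \<open>x \<le> M\<close> by (simp add: flow_def)
    next
      case 4
      then show ?thesis using far \<open>x \<le> M\<close> \<open>y \<le> M\<close> by (simp add: abs_minus_commute)
    qed simp
  qed
qed

text \<open>Detailed balance over the edge \<open>(x, x + 1)\<close> expresses \<open>a (x + 1)\<close> as a multiple of \<open>a x\<close>,
  so its solutions form a space of dimension one. The multiplicative form of this statement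
  also covers solutions that vanish at \<open>0\<close>.\<close>

lemma detailed_balance_proportional:
  assumes irr: "irreducible_bd M P"
    and a: "detailed_balance M P a" and b: "detailed_balance M P b"
    and "x \<le> M"
  shows "a x * b 0 = b x * a 0"
  using \<open>x \<le> M\<close>
proof (induction x)
  case (Suc x)
  let ?p = "P $$ (x, Suc x)" and ?q = "P $$ (Suc x, x)"
  have q: "?q > 0"
    using irr Suc.prems by (auto simp: irreducible_bd_def death_prob_def dest: bspec[of _ _ "Suc x"])
  have ea: "a x * ?p = a (Suc x) * ?q" and eb: "b x * ?p = b (Suc x) * ?q"
    using a b Suc.prems by (auto simp: detailed_balance_def)
  have "(a (Suc x) * b 0) * ?q = (a x * b 0) * ?p" by (simp add: ea[symmetric] mult_ac)
  also have "\<dots> = (b x * a 0) * ?p" using Suc by simp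
  also have "\<dots> = (b (Suc x) * a 0) * ?q" by (simp add: eb[symmetric] mult_ac)
  finally show ?case using q by simp
qed simp

lemma sum_reflect_atMost:
  fixes f :: "nat \<Rightarrow> real"
  shows "(\<Sum>x\<le>M. f (M - x)) = (\<Sum>x\<le>M. f x)"
  by (rule sum.nat_diff_reindex[of f "Suc M", unfolded lessThan_Suc_atMost, simplified])

lemma stationary_distribution_sum:
  "stationary_distribution M P \<pi> \<Longrightarrow> (\<Sum>x\<le>M. \<pi> $ x) = 1"
  by (simp add: stationary_distribution_def probability_vec_def lessThan_Suc_atMost)

lemma stationary_distribution_0_pos:
  assumes bd: "birth_death_chain M P" and irr: "irreducible_bd M P"
    and st: "stationary_distribution M P \<pi>"
  shows "\<pi> $ 0 > 0"
proof -
  have "\<pi> $ 0 \<noteq> 0"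
  proof
    assume 0: "\<pi> $ 0 = 0"
    have sq: "\<pi> $ x * P $$ (x, x + 1) = \<pi> $ (x + 1) * P $$ (x + 1, x)" if "x < M" for x
      using stationary_birth_death_detailed_balance[OF bd st] that
      by (auto simp: detailed_balance_def)
    have "\<pi> $ x = 0" if "x \<le> M" for x
      using that
    proof (induction x)
      case (Suc x)
      have "P $$ (Suc x, x) > 0"
        using irr Suc.prems
        by (auto simp: irreducible_bd_def death_prob_def dest: bspec[of _ _ "Suc x"])
      then show ?case using sq[of x] Suc by simp
    qed (rule 0)
    then show False using stationary_distribution_sum[OF st] by simp
  qed
  moreover have "\<pi> $ 0 \<ge> 0"
    using st by (auto simp: stationary_distribution_def probability_vec_def)
  ultimately show ?thesis by simp
qed

text \<open>The reflection of \<open>\<pi>\<close> also satisfies detailed balance, so it is proportional to \<open>\<pi>\<close>, and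
  the factor is one because both have total mass one.\<close>

lemma stationary_distribution_symmetric:
  assumes bd: "birth_death_chain M P" and irr: "irreducible_bd M P"
    and sym: "symmetric_bd M P" and st: "stationary_distribution M P \<pi>"
    and x: "x \<le> M"
  shows "\<pi> $ (M - x) = \<pi> $ x"
proof -
  let ?\<sigma> = "\<lambda>x. \<pi> $ (M - x)"
  have db: "detailed_balance M P (($) \<pi>)"
    by (rule stationary_birth_death_detailed_balance[OF bd st])
  have "detailed_balance M P ?\<sigma>" unfolding detailed_balance_def
  proof (intro allI impI)
    fix x y assume "x \<le> M" "y \<le> M"
    then have "P $$ (M - x, M - y) = P $$ (x, y)" "P $$ (M - y, M - x) = P $$ (y, x)"
      using sym unfolding symmetric_bd_def by blast+
    moreover have "\<pi> $ (M - x) * P $$ (M - x, M - y) = \<pi> $ (M - y) * P $$ (M - y, M - x)"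
      using db unfolding detailed_balance_def by (meson diff_le_self)
    ultimately show "?\<sigma> x * P $$ (x, y) = ?\<sigma> y * P $$ (y, x)" by metis
  qed
  then have ratio: "\<pi> $ x * ?\<sigma> 0 = ?\<sigma> x * \<pi> $ 0" if "x \<le> M" for x
    by (rule detailed_balance_proportional[OF irr db _ that])
  have "?\<sigma> 0 = (\<Sum>x\<le>M. \<pi> $ x) * ?\<sigma> 0"
    using stationary_distribution_sum[OF st] by simp
  also have "\<dots> = (\<Sum>x\<le>M. ?\<sigma> x) * \<pi> $ 0"
    unfolding sum_distrib_right using ratio by (intro sum.cong) (simp_all only: atMost_iff)
  also have "\<dots> = \<pi> $ 0"
    using sum_reflect_atMost[of "($) \<pi>" M] stationary_distribution_sum[OF st] by simp
  finally show ?thesis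
    using ratio[OF x] stationary_distribution_0_pos[OF bd irr st] by simp
qed

section \<open>Averaging preserves monotonicity\<close>

lemma one_step_birth_death:
  assumes bd: "birth_death_chain M P" and x: "x \<le> M"
  shows "one_step M P f x = f x
    + (if x < M then birth_prob P x * (f (x + 1) - f x) else 0)
    + (if 0 < x then death_prob P x * (f (x - 1) - f x) else 0)"
proof -
  have tm: "transition_matrix (M + 1) P"
    and far: "\<And>x y. x \<le> M \<Longrightarrow> y \<le> M \<Longrightarrow> \<bar>int x - int y\<bar> > 1 \<Longrightarrow> P $$ (x, y) = 0"
    using bd by (auto simp: birth_death_chain_def)
  have "one_step M P f x = f x * (\<Sum>y\<le>M. P $$ (x, y)) + (\<Sum>y\<le>M. P $$ (x, y) * (f y - f x))"
    unfolding one_step_def sum_distrib_left sum.distrib[symmetric]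
    by (intro sum.cong) (auto simp: algebra_simps)
  also have "(\<Sum>y\<le>M. P $$ (x, y) * (f y - f x))
      = (if x < M then P $$ (x, x + 1) * (f (x + 1) - f x) else 0)
      + (if 0 < x then P $$ (x, x - 1) * (f (x - 1) - f x) else 0)"
    by (rule sum_nearest_neighbours[OF x]) (use far x in auto)
  finally show ?thesis
    by (simp add: transition_matrix_row_sum[OF tm x] birth_prob_def death_prob_def)
qed

text \<open>With \<open>d x = f x - f (x + 1)\<close>, the decrement of the averaged function over the edge
  \<open>(x, x + 1)\<close> is \<open>(1 - p\<^sub>x - q\<^sub>x\<^sub>+\<^sub>1) d x + q\<^sub>x d (x - 1) + p\<^sub>x\<^sub>+\<^sub>1 d (x + 1)\<close>,
  and monotonicity of the chain is the nonnegativity of the first coefficient. The hypotheses only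
  concern the edges that occur here, so that the lemma applies to functions which are decreasing
  on a part of the state space.\<close>

lemma one_step_decreasing_at:
  assumes bd: "birth_death_chain M P" and mono: "monotone_bd M P" and x: "x < M"
    and here: "f (x + 1) \<le> f x"
    and left: "0 < x \<Longrightarrow> f x \<le> f (x - 1)"
    and right: "x + 1 < M \<Longrightarrow> f (x + 2) \<le> f (x + 1)"
  shows "one_step M P f (x + 1) \<le> one_step M P f x"
proof -
  have tm: "transition_matrix (M + 1) P" using bd by (simp add: birth_death_chain_def)
  define l where "l = (if 0 < x then death_prob P x * (f (x - 1) - f x) else 0)"
  define r where "r = (if x + 1 < M then birth_prob P (x + 1) * (f (x + 2) - f (x + 1)) else 0)"
  have "death_prob P x \<ge> 0"
    using transition_matrix_nonneg[OF tm, of x "x - 1"] x by (simp add: death_prob_def)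
  then have "l \<ge> 0" unfolding l_def using left by (cases "0 < x") auto
  moreover have "r \<le> 0"
  proof (cases "x + 1 < M")
    case True
    then have "birth_prob P (x + 1) \<ge> 0"
      using transition_matrix_nonneg[OF tm, of "x + 1" "x + 2"] by (simp add: birth_prob_def)
    then show ?thesis using right[OF True] True by (simp add: r_def mult_nonneg_nonpos)
  qed (simp add: r_def)
  moreover have "0 \<le> (1 - birth_prob P x - death_prob P (x + 1)) * (f x - f (x + 1))"
  proof (rule mult_nonneg_nonneg)
    have "birth_prob P x + death_prob P (x + 1) \<le> 1"
      using mono x unfolding monotone_bd_def by blast
    then show "0 \<le> 1 - birth_prob P x - death_prob P (x + 1)" by linarith
  qed (use here in linarith)
  moreover have "one_step M P f x = f x + birth_prob P x * (f (x + 1) - f x) + l"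
    using one_step_birth_death[OF bd, of x f] x by (simp add: l_def)
  moreover have "one_step M P f (x + 1)
      = f (x + 1) + r + death_prob P (x + 1) * (f x - f (x + 1))"
    using one_step_birth_death[OF bd, of "x + 1" f] x by (simp add: r_def)
  ultimately show ?thesis by (simp add: algebra_simps)
qed

lemma pow_mat_column_0_decreasing:
  assumes bd: "birth_death_chain M P" and mono: "monotone_bd M P" and "x < M"
  shows "(P ^\<^sub>m n) $$ (x + 1, 0) \<le> (P ^\<^sub>m n) $$ (x, 0)"
  using \<open>x < M\<close>
proof (induction n arbitrary: x)
  case 0
  have "P \<in> carrier_mat (M + 1) (M + 1)"
    using bd by (simp add: birth_death_chain_def transition_matrix_def)
  then show ?case using 0 by simp
next
  case (Suc n)
  have P: "P \<in> carrier_mat (M + 1) (M + 1)"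
    using bd by (simp add: birth_death_chain_def transition_matrix_def)
  let ?g = "\<lambda>z. (P ^\<^sub>m n) $$ (z, 0)"
  have "one_step M P ?g (x + 1) \<le> one_step M P ?g x"
    by (rule one_step_decreasing_at[OF bd mono Suc.prems])
      (use Suc.IH[of x] Suc.IH[of "x - 1"] Suc.IH[of "x + 1"] Suc.prems in auto)
  then show ?case
    using Suc.prems pow_mat_Suc_eq_one_step[OF P, of x 0 n]
      pow_mat_Suc_eq_one_step[OF P, of "x + 1" 0 n] by simp
qed

lemma one_step_reflect:
  assumes "symmetric_bd M P" and x: "x \<le> M"
  shows "one_step M P f (M - x) = one_step M P (\<lambda>y. f (M - y)) x"
proof -
  have "one_step M P f (M - x) = (\<Sum>y\<le>M. P $$ (M - x, M - y) * f (M - y))"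
    unfolding one_step_def by (rule sum_reflect_atMost[symmetric])
  also have "\<dots> = one_step M P (\<lambda>y. f (M - y)) x"
    unfolding one_step_def using assms by (intro sum.cong) (auto simp: symmetric_bd_def)
  finally show ?thesis .
qed

text \<open>The symmetrised function takes equal values at the two middle states. Hence, for an edge in the
  left half, the neighbouring edge on the right is again in the left half or has zero increment.\<close>

lemma symmetrised_column_0_decreasing:
  assumes bd: "birth_death_chain (2 * N + 1) P" and mono: "monotone_bd (2 * N + 1) P"
    and sym: "symmetric_bd (2 * N + 1) P" and "x < N"
  shows "(P ^\<^sub>m n) $$ (x + 1, 0) + (P ^\<^sub>m n) $$ (2 * N + 1 - (x + 1), 0)
    \<le> (P ^\<^sub>m n) $$ (x, 0) + (P ^\<^sub>m n) $$ (2 * N + 1 - x, 0)"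
  using \<open>x < N\<close>
proof (induction n arbitrary: x)
  case 0
  have "P \<in> carrier_mat (2 * N + 1 + 1) (2 * N + 1 + 1)"
    using bd by (simp add: birth_death_chain_def transition_matrix_def)
  then show ?case using 0 by simp
next
  case (Suc n)
  let ?M = "2 * N + 1"
  have P: "P \<in> carrier_mat (?M + 1) (?M + 1)"
    using bd by (simp add: birth_death_chain_def transition_matrix_def)
  let ?g = "\<lambda>z. (P ^\<^sub>m n) $$ (z, 0)"
  define e where "e z = ?g z + ?g (?M - z)" for z
  have step: "(P ^\<^sub>m Suc n) $$ (z, 0) + (P ^\<^sub>m Suc n) $$ (?M - z, 0) = one_step ?M P e z"
    if "z \<le> ?M" for z
    using that pow_mat_Suc_eq_one_step[OF P, of z 0 n]
      pow_mat_Suc_eq_one_step[OF P, of "?M - z" 0 n] one_step_reflect[OF sym that, of ?g]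
    by (simp add: e_def one_step_def sum.distrib distrib_left)
  have IH: "e (z + 1) \<le> e z" if "z < N" for z
    using Suc.IH[OF that] by (simp add: e_def)
  have "?M - N = N + 1" "?M - (N + 1) = N" by auto
  then have middle: "e (N + 1) = e N" unfolding e_def by simp
  have "one_step ?M P e (x + 1) \<le> one_step ?M P e x"
  proof (rule one_step_decreasing_at[OF bd mono])
    show "x < ?M" using Suc.prems by simp
    show "e (x + 1) \<le> e x" using IH Suc.prems by simp
    show "e x \<le> e (x - 1)" if "0 < x" using IH[of "x - 1"] Suc.prems that by simp
    show "e (x + 2) \<le> e (x + 1)"
    proof (cases "x + 1 = N")
      case True
      then have "x + 2 = N + 1" by simp
      with True middle show ?thesis by (simp only:)
    next
      case False
      then show ?thesis using IH[of "x + 1"] Suc.prems by simp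
    qed
  qed
  then show ?case using step[of x] step[of "x + 1"] Suc.prems by simp
qed

lemma symmetrised_column_0_minimal_at_middle:
  assumes bd: "birth_death_chain (2 * N + 1) P" and mono: "monotone_bd (2 * N + 1) P"
    and sym: "symmetric_bd (2 * N + 1) P" and x: "x \<le> 2 * N + 1"
  shows "(P ^\<^sub>m n) $$ (N, 0) + (P ^\<^sub>m n) $$ (N + 1, 0)
    \<le> (P ^\<^sub>m n) $$ (x, 0) + (P ^\<^sub>m n) $$ (2 * N + 1 - x, 0)"
proof -
  define e where "e z = (P ^\<^sub>m n) $$ (z, 0) + (P ^\<^sub>m n) $$ (2 * N + 1 - z, 0)" for z
  have left: "e N \<le> e z" if "z \<le> N" for z
    using that
  proof (induction rule: inc_induct)
    case (step m)
    then show ?case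
      using symmetrised_column_0_decreasing[OF bd mono sym, of m n] by (simp add: e_def)
  qed simp
  have "2 * N + 1 - N = N + 1" by simp
  then have eN: "e N = (P ^\<^sub>m n) $$ (N, 0) + (P ^\<^sub>m n) $$ (N + 1, 0)"
    unfolding e_def by simp
  have "e N \<le> e x"
  proof (cases "x \<le> N")
    case False
    then have "e N \<le> e (2 * N + 1 - x)" by (intro left) simp
    also have "\<dots> = e x" using x by (simp add: e_def)
    finally show ?thesis .
  qed (rule left)
  then show ?thesis by (simp only: eN) (simp add: e_def)
qed

section \<open>The halting state\<close>

lemma pow_mat_middle_le_stationary:
  assumes bd: "birth_death_chain (2 * N + 1) P" and irr: "irreducible_bd (2 * N + 1) P"
    and sym: "symmetric_bd (2 * N + 1) P" and mono: "monotone_bd (2 * N + 1) P"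
    and st: "stationary_distribution (2 * N + 1) P \<pi>"
  shows "(P ^\<^sub>m n) $$ (N + 1, 0) \<le> \<pi> $ 0"
proof -
  let ?M = "2 * N + 1"
  let ?g = "\<lambda>x. (P ^\<^sub>m n) $$ (x, 0)"
  have P: "P \<in> carrier_mat (?M + 1) (?M + 1)"
    using bd by (simp add: birth_death_chain_def transition_matrix_def)
  have nonneg: "\<pi> $ x \<ge> 0" if "x \<le> ?M" for x
    using st that by (auto simp: stationary_distribution_def probability_vec_def)
  have mean: "(\<Sum>x\<le>?M. \<pi> $ x * ?g x) = \<pi> $ 0"
    by (rule sum_stationary_pow_mat[OF P st]) simp
  have "(\<Sum>x\<le>?M. \<pi> $ x * ?g (?M - x)) = (\<Sum>x\<le>?M. \<pi> $ (?M - x) * ?g (?M - x))"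
    using stationary_distribution_symmetric[OF bd irr sym st] by (intro sum.cong) auto
  also have "\<dots> = \<pi> $ 0"
    using sum_reflect_atMost[of "\<lambda>x. \<pi> $ x * ?g x" ?M] mean by simp
  finally have mean': "(\<Sum>x\<le>?M. \<pi> $ x * ?g (?M - x)) = \<pi> $ 0" .
  have "?g N + ?g (N + 1) = (\<Sum>x\<le>?M. \<pi> $ x * (?g N + ?g (N + 1)))"
    unfolding sum_distrib_right[symmetric] stationary_distribution_sum[OF st] by simp
  also have "\<dots> \<le> (\<Sum>x\<le>?M. \<pi> $ x * (?g x + ?g (?M - x)))"
    using symmetrised_column_0_minimal_at_middle[OF bd mono sym] nonneg
    by (intro sum_mono mult_left_mono) auto
  also have "\<dots> = 2 * \<pi> $ 0"
    using mean mean' by (simp only: distrib_left sum.distrib)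
  finally have "?g N + ?g (N + 1) \<le> 2 * \<pi> $ 0" .
  moreover have "?g (N + 1) \<le> ?g N"
    by (rule pow_mat_column_0_decreasing[OF bd mono]) simp
  ultimately show ?thesis by simp
qed

theorem proposition4p8:
  fixes N :: nat and P :: "real mat" and \<pi> :: "real vec"
  assumes "birth_death_chain (2 * N + 1) P"
    and "irreducible_bd (2 * N + 1) P"
    and "symmetric_bd (2 * N + 1) P"
    and "monotone_bd (2 * N + 1) P"
    and "stationary_distribution (2 * N + 1) P \<pi>"
  shows "tv_halting_state (2 * N + 1) P \<pi> 0 (N + 1)"
  unfolding tv_halting_state_def
proof (intro conjI allI)
  let ?M = "2 * N + 1"
  show "N + 1 \<le> ?M" by simp
  fix n
  have P: "P \<in> carrier_mat (?M + 1) (?M + 1)"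
    using assms(1) by (simp add: birth_death_chain_def transition_matrix_def)
  have pos: "\<pi> $ 0 > 0" by (rule stationary_distribution_0_pos[OF assms(1,2,5)])
  have "detailed_balance ?M (P ^\<^sub>m n) (($) \<pi>)"
    by (intro detailed_balance_pow_mat P stationary_birth_death_detailed_balance assms(1,5))
  then have "\<pi> $ 0 * (P ^\<^sub>m n) $$ (0, N + 1) = \<pi> $ (N + 1) * (P ^\<^sub>m n) $$ (N + 1, 0)"
    by (simp add: detailed_balance_def)
  also have "\<dots> \<le> \<pi> $ (N + 1) * \<pi> $ 0"
    using assms(5) pow_mat_middle_le_stationary[OF assms]
    by (intro mult_left_mono) (auto simp: stationary_distribution_def probability_vec_def)
  finally have "(P ^\<^sub>m n) $$ (0, N + 1) \<le> \<pi> $ (N + 1)"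
    using pos by (simp add: mult.commute)
  then show "law_at P 0 n $ (N + 1) \<le> \<pi> $ (N + 1)"
    using P by (simp add: law_at_def)
qed

end
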